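(* Let $G=(V,E,w)$ be an undirected graph with $n$ vertices, $\{S_i\}_{i=1}^k$ a $k$-way partition of $V$ achieving $\rho(k)$, and $\ell\in[k]$ with $\ell<n$. Define, for $i\in[\ell]$, $\widehat f_i=\sum_{j=1}^\ell\langle\bar g_i,f_j\rangle f_j$ and $\widehat g_i=\sum_{j=1}^\ell\langle f_i,\bar g_j\rangle\bar g_j$. Then: 1. for any $i\in[\ell]$, $\|\bar g_i-\widehat f_i\|^2\le\gamma_i/\lambda_{\ell+1}$; 2. $\sum_{i=1}^\ell\|f_i-\widehat g_i\|^2\le\sum_{i=1}^\ell\gamma_i/\lambda_{\ell+1}$.
   Context: $G$ has nonnegative edge weights, $\deg(u)=\sum_vw_{uv}>0$, $w(S,T)$ = total weight of edges between $S$ and $T$ (for $S=T$, of edges inside $S$), $\mathrm{vol}(S)=\sum_{u\in S}\deg(u)$, $\Phi(S)=w(S,V\setminus S)/\mathrm{vol}(S)$, $\rho(k)=\min\max_i\Phi(A_i)$ over partitions into $k$ disjoint sets. $\mathcal N_G=I-D^{-1/2}AD^{-1/2}$ has eigenvalues $\lambda_1\le\cdots\le\lambda_n$ with orthonormal eigenvectors $f_1,\ldots,f_n$. Meta-graph $M$ on vertex set $[k]$: adjacency $A_M(i,j)=w(S_i,S_j)$ for $i\ne j$, $A_M(i,i)=2w(S_i,S_i)$; $\mathcal N_M=I-D_M^{-1/2}A_MD_M^{-1/2}$ has eigenvalues $\gamma_1\le\cdots\le\gamma_k$ with orthonormal eigenvectors $g_1,\ldots,g_k\in\mathbb{R}^k$.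 With $\chi_j$ the indicator vector of $S_j$ and $D$ the degree matrix of $G$, the blown-up vectors are $\bar g_i=\sum_{j=1}^k\frac{D^{1/2}\chi_j}{\|D^{1/2}\chi_j\|}g_i(j)\in\mathbb{R}^n$, i.e. $\bar g_i(u)=\sqrt{\deg(u)/\mathrm{vol}(S_j)}\,g_i(j)$ for $u\in S_j$. *)

theory Defs
  imports "HOL-Analysis.Analysis" "HOL-Library.Disjoint_Sets"
begin

text \<open>
  A graph \<open>G = (V, E, w)\<close> has the finite type \<open>'v\<close> as its vertex set, so \<open>n = CARD('v)\<close>; an edge
  is a two-element set of vertices, and \<open>w\<close> is only relevant on \<open>E\<close>.
\<close>

definition weighted_graph :: "'v::finite set set \<Rightarrow> ('v set \<Rightarrow> real) \<Rightarrow> bool" where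
  "weighted_graph E w \<longleftrightarrow> (\<forall>e\<in>E. card e = 2) \<and> (\<forall>e\<in>E. 0 \<le> w e)"

definition edge_weight :: "'v::finite set set \<Rightarrow> ('v set \<Rightarrow> real) \<Rightarrow> 'v \<Rightarrow> 'v \<Rightarrow> real" where
  "edge_weight E w u v = (if {u, v} \<in> E then w {u, v} else 0)"

definition deg :: "'v::finite set set \<Rightarrow> ('v set \<Rightarrow> real) \<Rightarrow> 'v \<Rightarrow> real" where
  "deg E w u = (\<Sum>v\<in>UNIV. edge_weight E w u v)"

definition vol :: "'v::finite set set \<Rightarrow> ('v set \<Rightarrow> real) \<Rightarrow> 'v set \<Rightarrow> real" where
  "vol E w S = (\<Sum>u\<in>S. deg E w u)"

text \<open>Each edge is counted once, so for \<open>S = T\<close> this is the total weight of the edges inside \<open>S\<close>.\<close>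

definition weight_between ::
    "'v::finite set set \<Rightarrow> ('v set \<Rightarrow> real) \<Rightarrow> 'v set \<Rightarrow> 'v set \<Rightarrow> real" where
  "weight_between E w S T = (\<Sum>e\<in>{e\<in>E. \<exists>u\<in>S. \<exists>v\<in>T. e = {u, v}}. w e)"

definition conductance :: "'v::finite set set \<Rightarrow> ('v set \<Rightarrow> real) \<Rightarrow> 'v set \<Rightarrow> real" where
  "conductance E w S = weight_between E w S (UNIV - S) / vol E w S"

definition rho :: "'v::finite set set \<Rightarrow> ('v set \<Rightarrow> real) \<Rightarrow> nat \<Rightarrow> real" where
  "rho E w k = Min {Max (conductance E w ` P) | P. partition_on UNIV P \<and> card P = k}"

text \<open>
  A \<open>k\<close>-way partition is a family indexed by a finite type \<open>'k\<close> with \<open>k = CARD('k)\<close>.  The parts are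
  nonempty (by \<^const>\<open>partition_on\<close>).
\<close>

definition kway_partition :: "('k::finite \<Rightarrow> 'v::finite set) \<Rightarrow> bool" where
  "kway_partition S \<longleftrightarrow> inj S \<and> partition_on UNIV (range S)"

definition achieves_rho ::
    "'v::finite set set \<Rightarrow> ('v set \<Rightarrow> real) \<Rightarrow> ('k::finite \<Rightarrow> 'v set) \<Rightarrow> bool" where
  "achieves_rho E w S \<longleftrightarrow>
     kway_partition S \<and> Max (range (\<lambda>i. conductance E w (S i))) = rho E w CARD('k)"

definition diag_matrix :: "('n::finite \<Rightarrow> real) \<Rightarrow> real^'n^'n" where
  "diag_matrix d = (\<chi> i j. if i = j then d i else 0)"

text \<open>
  \<open>I - D\<^sup>-\<^sup>1\<^sup>/\<^sup>2 A D\<^sup>-\<^sup>1\<^sup>/\<^sup>2\<close> for an adjacency matrix \<open>A\<close>, where \<open>D\<close> is the diagonal matrix of its row sums.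
\<close>

definition normalized_laplacian :: "real^'n::finite^'n \<Rightarrow> real^'n^'n" where
  "normalized_laplacian A =
     (let D' = diag_matrix (\<lambda>i. 1 / sqrt (\<Sum>j\<in>UNIV. A $ i $ j)) in mat 1 - D' ** A ** D')"

definition adjacency :: "'v::finite set set \<Rightarrow> ('v set \<Rightarrow> real) \<Rightarrow> real^'v^'v" where
  "adjacency E w = (\<chi> u v. edge_weight E w u v)"

definition meta_adjacency ::
    "'v::finite set set \<Rightarrow> ('v set \<Rightarrow> real) \<Rightarrow> ('k::finite \<Rightarrow> 'v set) \<Rightarrow> real^'k^'k" where
  "meta_adjacency E w S =
     (\<chi> i j. if i = j then 2 * weight_between E w (S i) (S i)
             else weight_between E w (S i) (S j))"

text \<open>
  All eigenvalues of \<open>M\<close> with multiplicity, in nondecreasing order, and corresponding orthonormal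
  eigenvectors; only the indices \<open>1, \<dots>, CARD('n)\<close> matter.
\<close>

definition ordered_eigensystem ::
    "real^'n::finite^'n \<Rightarrow> (nat \<Rightarrow> real) \<Rightarrow> (nat \<Rightarrow> real^'n) \<Rightarrow> bool" where
  "ordered_eigensystem M \<mu> x \<longleftrightarrow>
     (\<forall>i\<in>{1..CARD('n)}. M *v x i = \<mu> i *\<^sub>R x i) \<and>
     (\<forall>i\<in>{1..CARD('n)}. \<forall>j\<in>{1..CARD('n)}. x i \<bullet> x j = (if i = j then 1 else 0)) \<and>
     (\<forall>i\<in>{1..CARD('n)}. \<forall>j\<in>{1..CARD('n)}. i \<le> j \<longrightarrow> \<mu> i \<le> \<mu> j)"

definition indicator_vec :: "'v::finite set \<Rightarrow> real^'v" where
  "indicator_vec S = (\<chi> u. indicator S u)"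

definition blow_up ::
    "'v::finite set set \<Rightarrow> ('v set \<Rightarrow> real) \<Rightarrow> ('k::finite \<Rightarrow> 'v set) \<Rightarrow> real^'k \<Rightarrow> real^'v" where
  "blow_up E w S y =
     (let x = (\<lambda>j. diag_matrix (\<lambda>u. sqrt (deg E w u)) *v indicator_vec (S j))
      in \<Sum>j\<in>UNIV. (y $ j / norm (x j)) *\<^sub>R x j)"

definition f_hat ::
    "'v::finite set set \<Rightarrow> ('v set \<Rightarrow> real) \<Rightarrow> ('k::finite \<Rightarrow> 'v set) \<Rightarrow> (nat \<Rightarrow> real^'v) \<Rightarrow>
     (nat \<Rightarrow> real^'k) \<Rightarrow> nat \<Rightarrow> nat \<Rightarrow> real^'v" where
  "f_hat E w S f g l i = (\<Sum>j=1..l. (blow_up E w S (g i) \<bullet> f j) *\<^sub>R f j)"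

definition g_hat ::
    "'v::finite set set \<Rightarrow> ('v set \<Rightarrow> real) \<Rightarrow> ('k::finite \<Rightarrow> 'v set) \<Rightarrow> (nat \<Rightarrow> real^'v) \<Rightarrow>
     (nat \<Rightarrow> real^'k) \<Rightarrow> nat \<Rightarrow> nat \<Rightarrow> real^'v" where
  "g_hat E w S f g l i = (\<Sum>j=1..l. (f i \<bullet> blow_up E w S (g j)) *\<^sub>R blow_up E w S (g j))"

end

theory Submission
  imports Defs
begin

text \<open>
  Blowing up is a linear isometry that preserves the quadratic forms of the two Laplacians, so the
  Rayleigh quotient of \<open>g'\<^sub>i\<close> in \<open>G\<close>, the blow-up of \<open>g\<^sub>i\<close>, is \<open>\<gamma>\<^sub>i\<close>.  Expanding it in the
  eigenbasis \<open>f\<close>, the part orthogonal to \<open>f\<^sub>1, \<dots>, f\<^sub>l\<close> contributes at least \<open>\<lambda>\<^bsub>l+1\<^esub>\<close> times its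
  squared norm, and the rest is nonnegative; this is the first claim.  Both families are orthonormal,
  so the two sums of squared projection errors are equal to \<open>l - \<Sum>\<^sub>i\<^sub>,\<^sub>j \<langle>g'\<^sub>i, f\<^sub>j\<rangle>\<^sup>2\<close>, and the second
  claim follows from the first.
\<close>

section \<open>Orthonormal families\<close>

text \<open>As many orthonormal vectors as the dimension are independent, hence span the space. The
  residual lies in that span and is orthogonal to it, so it is orthogonal to itself and
  vanishes.\<close>

lemma orthonormal_expansion:
  fixes f :: "nat \<Rightarrow> real^'n::finite"
  assumes on: "\<And>i j. i \<in> {1..CARD('n)} \<Longrightarrow> j \<in> {1..CARD('n)} \<Longrightarrow> f i \<bullet> f j = (if i = j then 1 else 0)"
  shows "x = (\<Sum>j=1..CARD('n). (x \<bullet> f j) *\<^sub>R f j)"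
proof -
  let ?I = "{1..CARD('n)}"
  let ?B = "f ` ?I"
  have inj: "inj_on f ?I"
    by (rule inj_onI) (metis on zero_neq_one)
  have orth: "pairwise orthogonal ?B"
    by (auto simp: pairwise_def orthogonal_def on)
  have "0 \<notin> ?B"
    using on by (metis imageE inner_zero_left zero_neq_one)
  then have "independent ?B"
    using orth by (rule pairwise_orthogonal_independent[rotated])
  moreover have "card ?B = CARD('n)"
    using inj by (simp add: card_image)
  ultimately have span: "span ?B = UNIV"
    using card_ge_dim_independent[of ?B UNIV] by auto
  let ?r = "x - (\<Sum>j\<in>?I. (x \<bullet> f j) *\<^sub>R f j)"
  have "orthogonal ?r b" if b: "b \<in> ?B" for b
  proof -
    obtain i where i: "i \<in> ?I" "b = f i" using b by auto
    have "(\<Sum>j\<in>?I. (x \<bullet> f j) * (f j \<bullet> f i)) = (\<Sum>j\<in>?I. if j = i then x \<bullet> f j else 0)"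
      by (rule sum.cong) (use i on in auto)
    then show ?thesis
      using i by (simp add: orthogonal_def inner_diff_left inner_sum_left)
  qed
  moreover have "?r \<in> span ?B"
    unfolding span by (rule UNIV_I)
  ultimately have "orthogonal ?r ?r"
    by (rule orthogonal_to_span[rotated])
  then show ?thesis by (simp add: orthogonal_self)
qed

text \<open>Pythagoras: with \<open>?p\<close> the projection, \<open>x \<bullet> ?p\<close> and
  \<open>?p \<bullet> ?p\<close> both equal the sum of squared coefficients.\<close>

lemma norm_diff_projection:
  fixes x :: "'a::real_inner" and f :: "'i \<Rightarrow> 'a"
  assumes "finite I"
    and on: "\<And>i j. i \<in> I \<Longrightarrow> j \<in> I \<Longrightarrow> f i \<bullet> f j = (if i = j then 1 else 0)"
  shows "(norm (x - (\<Sum>j\<in>I. (x \<bullet> f j) *\<^sub>R f j)))\<^sup>2 = (norm x)\<^sup>2 - (\<Sum>j\<in>I. (x \<bullet> f j)\<^sup>2)"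
proof -
  let ?p = "\<Sum>j\<in>I. (x \<bullet> f j) *\<^sub>R f j"
  have "f i \<bullet> ?p = x \<bullet> f i" if "i \<in> I" for i
  proof -
    have "f i \<bullet> ?p = (\<Sum>j\<in>I. if j = i then x \<bullet> f j else 0)"
      unfolding inner_sum_right by (rule sum.cong) (use that on in auto)
    then show ?thesis using that assms(1) by simp
  qed
  then have pp: "?p \<bullet> ?p = (\<Sum>j\<in>I. (x \<bullet> f j)\<^sup>2)"
    by (simp add: inner_sum_left power2_eq_square)
  have xp: "x \<bullet> ?p = (\<Sum>j\<in>I. (x \<bullet> f j)\<^sup>2)"
    by (simp add: inner_sum_right power2_eq_square)
  show ?thesis
    using pp xp by (simp add: power2_norm_eq_inner inner_diff_left inner_diff_right inner_commute)
qed

text \<open>The common index set makes the squared norms add up to the same number on both sides;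
  what is subtracted is the double sum of squared cross products, which is symmetric in the two
  families.\<close>

lemma sum_projection_errors_commute:
  fixes f h :: "'i \<Rightarrow> 'a::real_inner"
  assumes "finite I"
    and f: "\<And>i j. i \<in> I \<Longrightarrow> j \<in> I \<Longrightarrow> f i \<bullet> f j = (if i = j then 1 else 0)"
    and h: "\<And>i j. i \<in> I \<Longrightarrow> j \<in> I \<Longrightarrow> h i \<bullet> h j = (if i = j then 1 else 0)"
  shows "(\<Sum>i\<in>I. (norm (f i - (\<Sum>j\<in>I. (f i \<bullet> h j) *\<^sub>R h j)))\<^sup>2) =
         (\<Sum>i\<in>I. (norm (h i - (\<Sum>j\<in>I. (h i \<bullet> f j) *\<^sub>R f j)))\<^sup>2)"
proof -
  have "(\<Sum>i\<in>I. \<Sum>j\<in>I. (f i \<bullet> h j)\<^sup>2) = (\<Sum>i\<in>I. \<Sum>j\<in>I. (h i \<bullet> f j)\<^sup>2)"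
    by (subst sum.swap) (simp add: inner_commute)
  moreover have "(\<Sum>i\<in>I. (norm (f i))\<^sup>2) = (\<Sum>i\<in>I. (norm (h i))\<^sup>2)"
    by (rule sum.cong) (simp_all add: power2_norm_eq_inner f h)
  ultimately show ?thesis
    by (simp add: norm_diff_projection[OF \<open>finite I\<close> f] norm_diff_projection[OF \<open>finite I\<close> h]
        sum_subtractf)
qed

text \<open>The bound is kept in product form because \<open>\<mu> (l + 1)\<close> may be zero here;
  the division is left to the place where positivity is known.\<close>

lemma ordered_eigensystem_projection_error:
  fixes M :: "real^'n::finite^'n"
  assumes es: "ordered_eigensystem M \<mu> f"
    and psd: "\<And>z. 0 \<le> z \<bullet> (M *v z)"
    and l: "l < CARD('n)"
  shows "\<mu> (l + 1) * (norm (x - (\<Sum>j=1..l. (x \<bullet> f j) *\<^sub>R f j)))\<^sup>2 \<le> x \<bullet> (M *v x)"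
proof -
  let ?n = "CARD('n)"
  have on: "f i \<bullet> f j = (if i = j then 1 else 0)" if "i \<in> {1..?n}" "j \<in> {1..?n}" for i j
    using es that by (auto simp: ordered_eigensystem_def)
  have ev: "M *v f i = \<mu> i *\<^sub>R f i" if "i \<in> {1..?n}" for i
    using es that by (auto simp: ordered_eigensystem_def)
  have mono: "\<mu> i \<le> \<mu> j" if "i \<in> {1..?n}" "j \<in> {1..?n}" "i \<le> j" for i j
    using es that by (auto simp: ordered_eigensystem_def)
  have nonneg: "0 \<le> \<mu> i" if "i \<in> {1..?n}" for i
    using psd[of "f i"] ev[OF that] on[OF that that] by simp
  have split: "{1..?n} = {1..l} \<union> {l+1..?n}" "{1..l} \<inter> {l+1..?n} = {}"
    using l by auto
  have expand: "x = (\<Sum>j=1..?n. (x \<bullet> f j) *\<^sub>R f j)"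
    using orthonormal_expansion on by blast
  have "M *v x = M *v (\<Sum>j=1..?n. (x \<bullet> f j) *\<^sub>R f j)"
    using expand by (rule arg_cong)
  also have "\<dots> = (\<Sum>j=1..?n. (x \<bullet> f j) *\<^sub>R (M *v f j))"
    by (simp add: linear_sum[OF matrix_vector_mul_linear] linear_cmul[OF matrix_vector_mul_linear])
  also have "\<dots> = (\<Sum>j=1..?n. (x \<bullet> f j) *\<^sub>R (\<mu> j *\<^sub>R f j))"
    using ev by (intro sum.cong) auto
  finally have quad: "x \<bullet> (M *v x) = (\<Sum>j=1..?n. \<mu> j * (x \<bullet> f j)\<^sup>2)"
    by (simp add: inner_sum_right power2_eq_square algebra_simps)
  \<comment> \<open>With all \<open>?n\<close> vectors the residual is zero, so Pythagoras turns
    into Parseval's identity.\<close>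
  have "(norm (x - (\<Sum>j=1..?n. (x \<bullet> f j) *\<^sub>R f j)))\<^sup>2 = (norm x)\<^sup>2 - (\<Sum>j=1..?n. (x \<bullet> f j)\<^sup>2)"
    by (rule norm_diff_projection) (use on in auto)
  then have total: "(norm x)\<^sup>2 = (\<Sum>j=1..?n. (x \<bullet> f j)\<^sup>2)"
    unfolding expand[symmetric] by simp
  have "(norm (x - (\<Sum>j=1..l. (x \<bullet> f j) *\<^sub>R f j)))\<^sup>2 = (norm x)\<^sup>2 - (\<Sum>j=1..l. (x \<bullet> f j)\<^sup>2)"
    by (rule norm_diff_projection) (use on l in auto)
  also have "\<dots> = (\<Sum>j=l+1..?n. (x \<bullet> f j)\<^sup>2)"
    unfolding total split(1) using split(2) by (subst sum.union_disjoint) auto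
  finally have "\<mu> (l + 1) * (norm (x - (\<Sum>j=1..l. (x \<bullet> f j) *\<^sub>R f j)))\<^sup>2
      = (\<Sum>j=l+1..?n. \<mu> (l + 1) * (x \<bullet> f j)\<^sup>2)"
    by (simp add: sum_distrib_left)
  also have "\<dots> \<le> (\<Sum>j=l+1..?n. \<mu> j * (x \<bullet> f j)\<^sup>2)"
    using l by (intro sum_mono mult_right_mono mono) auto
  \<comment> \<open>The first \<open>l\<close> terms are put back; they are nonnegative because each
    eigenvalue is the quadratic form at its unit eigenvector.\<close>
  also have "\<dots> \<le> (\<Sum>j=1..?n. \<mu> j * (x \<bullet> f j)\<^sup>2)"
    by (rule sum_mono2) (auto intro!: mult_nonneg_nonneg nonneg)
  finally show ?thesis unfolding quad .
qed

section \<open>The quadratic form of the normalized Laplacian\<close>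

text \<open>Apart from \<open>x \<bullet> x\<close>, the form depends only on \<open>A\<close> and
  the rescaled vector with entries \<open>x $ i / sqrt d\<close>, \<open>d\<close> being the row
  sum. This suits blown-up vectors, whose rescaling is constant on each part.\<close>

lemma normalized_laplacian_quadratic_form:
  fixes A :: "real^'n::finite^'n"
  shows "x \<bullet> (normalized_laplacian A *v x) = x \<bullet> x -
    (\<Sum>i\<in>UNIV. \<Sum>j\<in>UNIV. A $ i $ j * (x $ i / sqrt (\<Sum>m\<in>UNIV. A $ i $ m)) *
       (x $ j / sqrt (\<Sum>m\<in>UNIV. A $ j $ m)))"
proof -
  let ?s = "\<lambda>i. sqrt (\<Sum>m\<in>UNIV. A $ i $ m)"
  let ?D = "diag_matrix (\<lambda>i. 1 / ?s i)"
  have D: "?D *v y = (\<chi> i. y $ i / ?s i)" for y :: "real^'n"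
    by (simp add: vec_eq_iff matrix_vector_mult_def diag_matrix_def if_distrib[of "\<lambda>t. t * _"]
        cong: if_cong)
  have "normalized_laplacian A *v x = x - ?D *v (A *v (?D *v x))"
    by (simp add: normalized_laplacian_def Let_def matrix_vector_mult_diff_rdistrib
        matrix_vector_mul_assoc matrix_mul_assoc)
  then have "x \<bullet> (normalized_laplacian A *v x) = x \<bullet> x - x \<bullet> (?D *v (A *v (?D *v x)))"
    by (simp add: inner_diff_right)
  also have "x \<bullet> (?D *v (A *v (?D *v x))) =
      (\<Sum>i\<in>UNIV. \<Sum>j\<in>UNIV. A $ i $ j * (x $ i / ?s i) * (x $ j / ?s j))"
    unfolding D by (simp add: inner_vec_def matrix_vector_mult_def sum_distrib_left
        sum_divide_distrib mult_ac)
  finally show ?thesis .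
qed

text \<open>Estimate each product \<open>z i * z j\<close> by the mean of the two squares. Weighted
  by \<open>A\<close>, each family of squares sums to \<open>x \<bullet> x\<close>: the row sum
  cancels the denominator of \<open>(z i)\<^sup>2\<close>, and symmetry of \<open>A\<close> handles
  \<open>(z j)\<^sup>2\<close>.\<close>

lemma normalized_laplacian_psd:
  fixes A :: "real^'n::finite^'n"
  assumes nonneg: "\<And>i j. 0 \<le> A $ i $ j" and sym: "\<And>i j. A $ i $ j = A $ j $ i"
    and pos: "\<And>i. 0 < (\<Sum>m\<in>UNIV. A $ i $ m)"
  shows "0 \<le> x \<bullet> (normalized_laplacian A *v x)"
proof -
  let ?d = "\<lambda>i. \<Sum>m\<in>UNIV. A $ i $ m"
  define z where "z i = x $ i / sqrt (?d i)" for i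
  have row: "(\<Sum>j\<in>UNIV. A $ i $ j * (z i)\<^sup>2) = (x $ i)\<^sup>2" for i
    using pos[of i] unfolding sum_distrib_right[symmetric] by (simp add: z_def power_divide)
  have e1: "(\<Sum>i\<in>UNIV. \<Sum>j\<in>UNIV. A $ i $ j * (z i)\<^sup>2) = x \<bullet> x"
    unfolding row by (simp add: inner_vec_def power2_eq_square)
  have "(\<Sum>i\<in>UNIV. \<Sum>j\<in>UNIV. A $ i $ j * (z j)\<^sup>2) = (\<Sum>i\<in>UNIV. \<Sum>j\<in>UNIV. A $ i $ j * (z i)\<^sup>2)"
    by (subst sum.swap) (simp add: sym)
  with e1 have e2: "(\<Sum>i\<in>UNIV. \<Sum>j\<in>UNIV. A $ i $ j * (z j)\<^sup>2) = x \<bullet> x" by simp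
  have "(\<Sum>i\<in>UNIV. \<Sum>j\<in>UNIV. A $ i $ j * z i * z j)
      \<le> (\<Sum>i\<in>UNIV. \<Sum>j\<in>UNIV. A $ i $ j * (z i)\<^sup>2 / 2 + A $ i $ j * (z j)\<^sup>2 / 2)"
  proof (intro sum_mono)
    fix i j
    have "z i * z j \<le> ((z i)\<^sup>2 + (z j)\<^sup>2) / 2"
      using zero_le_power2[of "z i - z j"] by (simp add: power2_diff)
    then show "A $ i $ j * z i * z j \<le> A $ i $ j * (z i)\<^sup>2 / 2 + A $ i $ j * (z j)\<^sup>2 / 2"
      using mult_left_mono[OF _ nonneg[of i j]] by (fastforce simp: algebra_simps)
  qed
  also have "\<dots> = x \<bullet> x"
    using e1 e2 by (simp add: sum.distrib sum_divide_distrib[symmetric])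
  finally show ?thesis
    unfolding normalized_laplacian_quadratic_form z_def by simp
qed

section \<open>Edge weights between vertex sets\<close>

lemma edge_weight_commute: "edge_weight E w u v = edge_weight E w v u"
  by (simp add: edge_weight_def insert_commute)

text \<open>Rewrites the double sum over ordered pairs of vertices so that it can be compared with
  \<open>weight_between\<close>, which sums over unordered edges.\<close>

lemma sum_edge_weight_Times:
  "(\<Sum>u\<in>S. \<Sum>v\<in>T. edge_weight E w u v) = (\<Sum>(u, v)\<in>{(u, v)\<in>S \<times> T. {u, v} \<in> E}. w {u, v})"
proof -
  have "(\<Sum>u\<in>S. \<Sum>v\<in>T. edge_weight E w u v) =
      (\<Sum>p\<in>S \<times> T. if {fst p, snd p} \<in> E then w {fst p, snd p} else 0)"
    by (simp add: sum.cartesian_product edge_weight_def case_prod_beta)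
  also have "\<dots> = (\<Sum>p\<in>{p\<in>S \<times> T. {fst p, snd p} \<in> E}. w {fst p, snd p})"
    by (rule sum.inter_filter[symmetric]) simp
  also have "{p\<in>S \<times> T. {fst p, snd p} \<in> E} = {(u, v)\<in>S \<times> T. {u, v} \<in> E}"
    by auto
  finally show ?thesis by (simp add: case_prod_beta)
qed

text \<open>For disjoint sets an edge determines which endpoint lies in \<open>S\<close> and which
  in \<open>T\<close>, so ordered pairs and edges correspond one to one.\<close>

lemma weight_between_disjoint:
  assumes "S \<inter> T = {}"
  shows "weight_between E w S T = (\<Sum>u\<in>S. \<Sum>v\<in>T. edge_weight E w u v)"
proof -
  let ?P = "{(u, v)\<in>S \<times> T. {u, v} \<in> E}"
  have inj: "inj_on (\<lambda>(u, v). {u, v}) ?P"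
    using assms by (auto simp: inj_on_def doubleton_eq_iff)
  have im: "{e\<in>E. \<exists>u\<in>S. \<exists>v\<in>T. e = {u, v}} = (\<lambda>(u, v). {u, v}) ` ?P"
    by auto
  show ?thesis
    unfolding weight_between_def sum_edge_weight_Times im sum.reindex[OF inj]
    by (simp add: case_prod_beta)
qed

text \<open>Every edge inside \<open>S\<close> comes from exactly two ordered pairs, which is the
  origin of the factor 2 on the diagonal of the meta-graph.\<close>

lemma weight_between_self:
  assumes "\<forall>e\<in>E. card e = 2"
  shows "2 * weight_between E w S S = (\<Sum>u\<in>S. \<Sum>v\<in>S. edge_weight E w u v)"
proof -
  let ?P = "{(u, v)\<in>S \<times> S. {u, v} \<in> E}"
  let ?F = "{e\<in>E. \<exists>u\<in>S. \<exists>v\<in>S. e = {u, v}}"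
  have two: "(\<Sum>p\<in>{p\<in>?P. (case p of (u, v) \<Rightarrow> {u, v}) = e}. case p of (u, v) \<Rightarrow> w {u, v}) = 2 * w e"
    if e: "e \<in> ?F" for e
  proof -
    obtain a b where ab: "a \<in> S" "b \<in> S" "e = {a, b}" "e \<in> E" using e by auto
    \<comment> \<open>A loop would come from a single ordered pair; edges of cardinality 2 exclude
      it.\<close>
    with assms have "a \<noteq> b" by force
    have "{p\<in>?P. (case p of (u, v) \<Rightarrow> {u, v}) = e} = {(a, b), (b, a)}"
      using ab(1,2,4) unfolding ab(3)
      by (intro set_eqI) (simp split: prod.split add: doubleton_eq_iff, metis insert_commute)
    then show ?thesis using \<open>a \<noteq> b\<close> ab(3) by (simp add: insert_commute[of b a])
  qed
  have "(\<Sum>u\<in>S. \<Sum>v\<in>S. edge_weight E w u v) = (\<Sum>(u, v)\<in>?P. w {u, v})"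
    by (rule sum_edge_weight_Times)
  also have "\<dots> = (\<Sum>e\<in>?F. \<Sum>p\<in>{p\<in>?P. (case p of (u, v) \<Rightarrow> {u, v}) = e}. case p of (u, v) \<Rightarrow> w {u, v})"
    by (rule sum.group[symmetric]) auto
  also have "\<dots> = 2 * weight_between E w S S"
    unfolding weight_between_def sum_distrib_left by (rule sum.cong) (use two in auto)
  finally show ?thesis by simp
qed

section \<open>Blown-up vectors\<close>

text \<open>Describing the parts as fibres of a map \<open>c\<close> turns sums over parts into sums
  grouped by \<open>c\<close>; surjectivity records that no part is empty.\<close>

lemma kway_partition_class:
  assumes "kway_partition S"
  obtains c where "\<And>j. S j = {u. c u = j}" "surj c"
proof -
  have inj: "inj S" and part: "partition_on UNIV (range S)"
    using assms by (auto simp: kway_partition_def)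
  have "\<exists>j. u \<in> S j" for u
    using part by (force simp: partition_on_def)
  then obtain c where c: "\<And>u. u \<in> S (c u)" by metis
  have "c u = j" if "u \<in> S j" for u j
    using part c[of u] that inj by (metis disjointD disjoint_iff injD partition_on_def rangeI)
  then have *: "S j = {u. c u = j}" for j using c by auto
  have "S j \<noteq> {}" for j
    using part by (metis partition_on_def rangeI)
  then have "surj c" using * by (auto simp: surj_def) metis
  with * that show thesis by blast
qed

context
  fixes E :: "'v::finite set set" and w :: "'v set \<Rightarrow> real"
    and S :: "'k::finite \<Rightarrow> 'v set" and c :: "'v \<Rightarrow> 'k"
  assumes graph: "weighted_graph E w"
    and deg_pos: "\<And>u. 0 < deg E w u"
    and S_eq: "\<And>j. S j = {u. c u = j}"
    and surj_c: "surj c"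
begin

lemma sum_parts: "(\<Sum>j\<in>UNIV. \<Sum>u\<in>S j. h u) = (\<Sum>u\<in>UNIV. h u)" for h :: "'v \<Rightarrow> real"
  using sum.group[of "UNIV :: 'v set" "UNIV :: 'k set" c h] by (simp add: S_eq)

lemma vol_pos: "0 < vol E w (S j)"
proof -
  have "S j \<noteq> {}" using surjD[OF surj_c, of j] by (auto simp: S_eq)
  then show ?thesis unfolding vol_def by (intro sum_pos) (auto simp: deg_pos)
qed

text \<open>Counting ordered pairs gives one formula for diagonal and off-diagonal entries.\<close>

lemma meta_adjacency_nth:
  "meta_adjacency E w S $ i $ j = (\<Sum>u\<in>S i. \<Sum>v\<in>S j. edge_weight E w u v)"
proof (cases "i = j")
  case True
  then show ?thesis
    using graph by (simp add: meta_adjacency_def weight_between_self weighted_graph_def)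
next
  case False
  then have "S i \<inter> S j = {}" by (auto simp: S_eq)
  with False show ?thesis by (simp add: meta_adjacency_def weight_between_disjoint)
qed

text \<open>Identifies the degrees of the meta-graph with the volumes by which
  \<open>blow_up\<close> normalizes.\<close>

lemma meta_adjacency_row_sum: "(\<Sum>j\<in>UNIV. meta_adjacency E w S $ i $ j) = vol E w (S i)"
proof -
  have "(\<Sum>j\<in>UNIV. meta_adjacency E w S $ i $ j)
      = (\<Sum>u\<in>S i. \<Sum>j\<in>UNIV. \<Sum>v\<in>S j. edge_weight E w u v)"
    unfolding meta_adjacency_nth by (rule sum.swap)
  then show ?thesis by (simp add: sum_parts vol_def deg_def)
qed

text \<open>At \<open>u\<close> only the summand of the part \<open>c u\<close> survives, and the
  squared norm of its scaled indicator is the sum of the degrees in that part.\<close>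

lemma blow_up_nth:
  "blow_up E w S y $ u = sqrt (deg E w u) * (y $ c u / sqrt (vol E w (S (c u))))"
proof -
  let ?x = "\<lambda>j. diag_matrix (\<lambda>u. sqrt (deg E w u)) *v indicator_vec (S j)"
  have x: "?x j $ v = (if c v = j then sqrt (deg E w v) else 0)" for j v
    by (simp add: matrix_vector_mult_def diag_matrix_def indicator_vec_def S_eq indicator_def
        if_distrib[of "\<lambda>t. t * _"] cong: if_cong)
  have "?x j \<bullet> ?x j = (\<Sum>v\<in>UNIV. if c v = j then deg E w v else 0)" for j
    unfolding inner_vec_def x using deg_pos by (intro sum.cong) (auto simp: less_imp_le)
  then have "?x j \<bullet> ?x j = vol E w (S j)" for j
    by (simp add: vol_def S_eq sum.If_cases)
  then have "norm (?x j) = sqrt (vol E w (S j))" for j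
    by (simp add: norm_eq_sqrt_inner)
  then have "blow_up E w S y $ u
      = (\<Sum>j\<in>UNIV. if c u = j then y $ j / sqrt (vol E w (S j)) * sqrt (deg E w u) else 0)"
    unfolding blow_up_def Let_def by (simp add: x if_distrib[of "\<lambda>t. _ * t"] cong: if_cong)
  then show ?thesis by simp
qed

text \<open>On the part \<open>S j\<close> the degrees add up to its volume, which cancels the
  normalization and leaves \<open>y $ j * z $ j\<close>.\<close>

lemma inner_blow_up: "blow_up E w S y \<bullet> blow_up E w S z = y \<bullet> z"
proof -
  have "blow_up E w S y \<bullet> blow_up E w S z
      = (\<Sum>u\<in>UNIV. deg E w u * (y $ c u * z $ c u / vol E w (S (c u))))"
    unfolding inner_vec_def
  proof (intro sum.cong refl)
    fix u
    have "sqrt (deg E w u) * sqrt (deg E w u) = deg E w u"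
      "sqrt (vol E w (S (c u))) * sqrt (vol E w (S (c u))) = vol E w (S (c u))"
      using deg_pos vol_pos by (simp_all add: less_imp_le)
    then show "blow_up E w S y $ u \<bullet> blow_up E w S z $ u
        = deg E w u * (y $ c u * z $ c u / vol E w (S (c u)))"
      by (simp add: blow_up_nth)
  qed
  also have "\<dots> = (\<Sum>j\<in>UNIV. \<Sum>u\<in>S j. deg E w u * (y $ c u * z $ c u / vol E w (S (c u))))"
    by (rule sum_parts[symmetric])
  also have "\<dots> = (\<Sum>j\<in>UNIV. \<Sum>u\<in>S j. deg E w u * (y $ j * z $ j / vol E w (S j)))"
    by (intro sum.cong) (auto simp: S_eq)
  also have "\<dots> = (\<Sum>j\<in>UNIV. vol E w (S j) * (y $ j * z $ j / vol E w (S j)))"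
    unfolding vol_def by (simp only: sum_distrib_right)
  also have "\<dots> = y \<bullet> z"
    unfolding inner_vec_def using vol_pos by (intro sum.cong) (auto simp: less_imp_neq[symmetric])
  finally show ?thesis .
qed

text \<open>After rescaling by the degrees, the blow-up takes the constant value \<open>z j\<close>
  on \<open>S j\<close>, where \<open>z\<close> is \<open>y\<close> rescaled by the degrees of the
  meta-graph. The double sum over vertices therefore splits into blocks, one per pair of parts, each
  with total weight an entry of \<open>meta_adjacency\<close>; the terms
  \<open>x \<bullet> x\<close> agree by isometry.\<close>

lemma blow_up_quadratic_form:
  "blow_up E w S y \<bullet> (normalized_laplacian (adjacency E w) *v blow_up E w S y)
     = y \<bullet> (normalized_laplacian (meta_adjacency E w S) *v y)"
proof -
  define z where "z j = y $ j / sqrt (vol E w (S j))" for j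
  have row: "(\<Sum>v\<in>UNIV. adjacency E w $ u $ v) = deg E w u" for u
    by (simp add: adjacency_def deg_def)
  have z: "blow_up E w S y $ u / sqrt (deg E w u) = z (c u)" for u
    using deg_pos[of u] by (simp add: blow_up_nth z_def)
  have "(\<Sum>u\<in>UNIV. \<Sum>v\<in>UNIV. edge_weight E w u v * z (c u) * z (c v))
      = (\<Sum>i\<in>UNIV. \<Sum>u\<in>S i. \<Sum>j\<in>UNIV. \<Sum>v\<in>S j. edge_weight E w u v * z (c u) * z (c v))"
    by (simp add: sum_parts)
  also have "\<dots> = (\<Sum>i\<in>UNIV. \<Sum>u\<in>S i. \<Sum>j\<in>UNIV. \<Sum>v\<in>S j. edge_weight E w u v * z i * z j)"
    by (intro sum.cong) (auto simp: S_eq)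
  also have "\<dots> = (\<Sum>i\<in>UNIV. \<Sum>j\<in>UNIV. \<Sum>u\<in>S i. \<Sum>v\<in>S j. edge_weight E w u v * z i * z j)"
    by (intro sum.cong refl sum.swap)
  also have "\<dots> = (\<Sum>i\<in>UNIV. \<Sum>j\<in>UNIV. meta_adjacency E w S $ i $ j * z i * z j)"
    by (simp add: meta_adjacency_nth sum_distrib_right)
  finally show ?thesis
    unfolding normalized_laplacian_quadratic_form row meta_adjacency_row_sum z inner_blow_up
    by (simp add: z_def adjacency_def)
qed

end

theorem theorem3:
  fixes E :: "'v::finite set set" and w :: "'v set \<Rightarrow> real"
    and S :: "'k::finite \<Rightarrow> 'v set" and l :: nat
    and lam gam :: "nat \<Rightarrow> real" and f :: "nat \<Rightarrow> real^'v" and g :: "nat \<Rightarrow> real^'k"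
  assumes "weighted_graph E w"
    and "\<And>u. 0 < deg E w u"
    and "achieves_rho E w S"
    and "ordered_eigensystem (normalized_laplacian (adjacency E w)) lam f"
    and "ordered_eigensystem (normalized_laplacian (meta_adjacency E w S)) gam g"
    and "l \<in> {1..CARD('k)}" and "l < CARD('v)"
    and "lam (l + 1) \<noteq> 0"
  shows "(\<forall>i\<in>{1..l}. (norm (blow_up E w S (g i) - f_hat E w S f g l i))\<^sup>2 \<le> gam i / lam (l + 1)) \<and>
         (\<Sum>i=1..l. (norm (f i - g_hat E w S f g l i))\<^sup>2) \<le> (\<Sum>i=1..l. gam i / lam (l + 1))"
proof -
  let ?N = "normalized_laplacian (adjacency E w)"
  let ?h = "\<lambda>i. blow_up E w S (g i)"
  obtain c where c: "\<And>j. S j = {u. c u = j}" "surj c"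
    using kway_partition_class assms(3) unfolding achieves_rho_def by blast
  have psd: "0 \<le> x \<bullet> (?N *v x)" for x
  proof (rule normalized_laplacian_psd)
    show "0 \<le> adjacency E w $ i $ j" for i j
      using assms(1) by (simp add: adjacency_def edge_weight_def weighted_graph_def)
    show "adjacency E w $ i $ j = adjacency E w $ j $ i" for i j
      by (simp add: adjacency_def edge_weight_commute)
    show "0 < (\<Sum>m\<in>UNIV. adjacency E w $ i $ m)" for i
      using assms(2)[of i] by (simp add: adjacency_def deg_def)
  qed
  have f_on: "f i \<bullet> f j = (if i = j then 1 else 0)" if "i \<in> {1..l}" "j \<in> {1..l}" for i j
    using assms(4,7) that by (auto simp: ordered_eigensystem_def)
  have g_on: "g i \<bullet> g j = (if i = j then 1 else 0)" if "i \<in> {1..l}" "j \<in> {1..l}" for i j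
    using assms(5,6) that by (auto simp: ordered_eigensystem_def)
  have h_on: "?h i \<bullet> ?h j = (if i = j then 1 else 0)" if "i \<in> {1..l}" "j \<in> {1..l}" for i j
    using inner_blow_up[OF assms(1,2) c] g_on[OF that] by simp
  \<comment> \<open>Since \<open>l < CARD('v)\<close>, the index \<open>l + 1\<close> is still
    within the eigensystem. Semidefiniteness then gives \<open>0 \<le> lam (l + 1)\<close>, and
    being nonzero it is positive.\<close>
  have "f (l + 1) \<bullet> (?N *v f (l + 1)) = lam (l + 1)"
    using assms(4,7) by (simp add: ordered_eigensystem_def)
  with psd[of "f (l + 1)"] assms(8) have lam_pos: "0 < lam (l + 1)" by simp
  have part1: "(norm (?h i - f_hat E w S f g l i))\<^sup>2 \<le> gam i / lam (l + 1)" if i: "i \<in> {1..l}" for i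
  proof -
    have "normalized_laplacian (meta_adjacency E w S) *v g i = gam i *\<^sub>R g i"
      using assms(5,6) i by (auto simp: ordered_eigensystem_def)
    \<comment> \<open>The value is computed in the meta-graph, where \<open>g i\<close> is a unit
      eigenvector; \<open>?h i\<close> itself need not be an eigenvector of
      \<open>?N\<close>.\<close>
    then have "?h i \<bullet> (?N *v ?h i) = gam i"
      using g_on[OF i i] by (simp add: blow_up_quadratic_form[OF assms(1,2) c])
    then have "lam (l + 1) * (norm (?h i - f_hat E w S f g l i))\<^sup>2 \<le> gam i"
      using ordered_eigensystem_projection_error[OF assms(4) psd assms(7), of "?h i"]
      by (simp add: f_hat_def)
    then show ?thesis using lam_pos by (simp add: field_simps)
  qed
  have "(\<Sum>i=1..l. (norm (f i - g_hat E w S f g l i))\<^sup>2)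
      = (\<Sum>i=1..l. (norm (?h i - f_hat E w S f g l i))\<^sup>2)"
    unfolding f_hat_def g_hat_def
    using f_on h_on by (intro sum_projection_errors_commute) auto
  also have "\<dots> \<le> (\<Sum>i=1..l. gam i / lam (l + 1))"
    by (intro sum_mono part1)
  finally show ?thesis using part1 by blast
qed

end
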